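(* Let $\Gamma$ be a countable group such that every action of $\Gamma$ by automorphisms on a triangle-free graph is finitely approximable by finite triangle-free graphs. Then $\Gamma$ has the $2$-RZ property.
   Context: The profinite topology on a discrete group $\Gamma$ is the group topology generated by the basic open sets $gK$, where $g\in\Gamma$ and $K$ is a finite index normal subgroup of $\Gamma$. For $n\in\mathbb{N}$, $\Gamma$ has the $n$-RZ ($n$-Ribes-Zalesskii) property if any product $H_1H_2\cdots H_n$ of finitely generated subgroups of $\Gamma$ is closed in the profinite topology on $\Gamma$. Graphs are simple and undirected; a graph is triangle-free if it contains no clique on $3$ elements. An action $\alpha$ of $\Gamma$ by automorphisms on a (possibly infinite) triangle-free graph $X$ is finitely approximable (by finite triangle-free graphs) if for every finite $F\subseteq\Gamma$ with $1\in F$ and every finite $X_0\subseteq X$ there exist a finite triangle-free graph $Y$, an action $\beta$ of $\Gamma$ on $Y$ by automorphisms, and an injection $e:\alpha[F\times X_0]\to Y$ which is an embedding of the induced subgraph of $X$ on $\alpha[F\times X_0]=\{\alpha(f,x): f\in F, x\in X_0\}$ into $Y$ (preserving both edges and non-edges) and satisfies $\beta(f,e(x))=e(\alpha(f,x))$ for all $f\in F$, $x\in X_0$. *)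

theory Defs
  imports
    "HOL-Algebra.Generated_Groups"
    "HOL-Algebra.Group_Action"
    "HOL-Analysis.Abstract_Topology"
    "HOL-Library.Countable_Set"
    "HOL-Library.Infinite_Typeclass"
begin

definition finite_index_normal :: "('g, 'm) monoid_scheme \<Rightarrow> 'g set \<Rightarrow> bool" where
  "finite_index_normal G K \<longleftrightarrow> K \<lhd> G \<and> finite (rcosets\<^bsub>G\<^esub> K)"

definition profinite_topology :: "('g, 'm) monoid_scheme \<Rightarrow> 'g topology" where
  "profinite_topology G =
     topology_generated_by {g <#\<^bsub>G\<^esub> K | g K. g \<in> carrier G \<and> finite_index_normal G K}"

definition fg_subgroup :: "('g, 'm) monoid_scheme \<Rightarrow> 'g set \<Rightarrow> bool" where
  "fg_subgroup G H \<longleftrightarrow> (\<exists>S. finite S \<and> S \<subseteq> carrier G \<and> H = generate G S)"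

definition subset_product :: "('g, 'm) monoid_scheme \<Rightarrow> 'g set list \<Rightarrow> 'g set" where
  "subset_product G Hs = foldr (set_mult G) Hs {\<one>\<^bsub>G\<^esub>}"

definition RZ_property :: "nat \<Rightarrow> ('g, 'm) monoid_scheme \<Rightarrow> bool" where
  "RZ_property n G \<longleftrightarrow>
     (\<forall>Hs. length Hs = n \<and> (\<forall>H\<in>set Hs. fg_subgroup G H) \<longrightarrow>
        closedin (profinite_topology G) (subset_product G Hs))"

definition simple_graph :: "'v set \<Rightarrow> ('v \<times> 'v) set \<Rightarrow> bool" where
  "simple_graph V E \<longleftrightarrow> E \<subseteq> V \<times> V \<and> sym E \<and> irrefl E"

definition clique :: "'v set \<Rightarrow> ('v \<times> 'v) set \<Rightarrow> 'v set \<Rightarrow> bool" where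
  "clique V E C \<longleftrightarrow> C \<subseteq> V \<and> (\<forall>u\<in>C. \<forall>v\<in>C. u \<noteq> v \<longrightarrow> (u, v) \<in> E)"

definition triangle_free_graph :: "'v set \<Rightarrow> ('v \<times> 'v) set \<Rightarrow> bool" where
  "triangle_free_graph V E \<longleftrightarrow> simple_graph V E \<and> \<not> (\<exists>C. clique V E C \<and> card C = 3)"

definition graph_action ::
  "('g, 'm) monoid_scheme \<Rightarrow> 'v set \<Rightarrow> ('v \<times> 'v) set \<Rightarrow> ('g \<Rightarrow> 'v \<Rightarrow> 'v) \<Rightarrow> bool" where
  "graph_action G V E \<alpha> \<longleftrightarrow> group_action G V \<alpha> \<and>
     (\<forall>g\<in>carrier G. \<forall>u\<in>V. \<forall>v\<in>V. (\<alpha> g u, \<alpha> g v) \<in> E \<longleftrightarrow> (u, v) \<in> E)"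

definition induced_embedding ::
  "'v set \<Rightarrow> ('v \<times> 'v) set \<Rightarrow> 'w set \<Rightarrow> ('w \<times> 'w) set \<Rightarrow> ('v \<Rightarrow> 'w) \<Rightarrow> bool" where
  "induced_embedding A E W D e \<longleftrightarrow> e ` A \<subseteq> W \<and> inj_on e A \<and>
     (\<forall>u\<in>A. \<forall>v\<in>A. (e u, e v) \<in> D \<longleftrightarrow> (u, v) \<in> E)"

text \<open>The finite graphs \<open>Y\<close> are taken with vertices in \<^typ>\<open>nat\<close>; every finite graph
  is isomorphic to such a graph. The vertex set of the graph acted upon may be infinite
  and lies in an arbitrary type \<open>'v\<close>.  A hypothesis about all actions on triangle-free graphs
  has to fix \<open>'v\<close>; it should then be infinite. For a countable group any infinite \<open>'v\<close> gives
  the same hypothesis, because approximability only involves the orbits of the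
  finite set \<open>X0\<close>, whose union is countable.\<close>

definition finitely_approximable ::
  "('g, 'm) monoid_scheme \<Rightarrow> 'v set \<Rightarrow> ('v \<times> 'v) set \<Rightarrow> ('g \<Rightarrow> 'v \<Rightarrow> 'v) \<Rightarrow> bool" where
  "finitely_approximable G V E \<alpha> \<longleftrightarrow>
     (\<forall>F X0. finite F \<and> F \<subseteq> carrier G \<and> \<one>\<^bsub>G\<^esub> \<in> F \<and> finite X0 \<and> X0 \<subseteq> V \<longrightarrow>
        (\<exists>(Y :: nat set) D \<beta> e.
           finite Y \<and> triangle_free_graph Y D \<and> graph_action G Y D \<beta> \<and>
           induced_embedding {\<alpha> f x | f x. f \<in> F \<and> x \<in> X0} E Y D e \<and>
           (\<forall>f\<in>F. \<forall>x\<in>X0. \<beta> f (e x) = e (\<alpha> f x))))"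

end

theory Submission
  imports Defs "HOL-Algebra.Left_Coset"
begin

text \<open>
  Let \<open>g\<close> lie outside \<open>H\<^sub>1 H\<^sub>2\<close>, where \<open>H\<^sub>1\<close> and \<open>H\<^sub>2\<close> are finitely generated. The idea is to
  write the statement \<open>g \<notin> H\<^sub>1 H\<^sub>2\<close> as a non-edge of a graph on which the group acts. Take the
  bipartite graph whose two sides are the left cosets of \<open>H\<^sub>1\<close> and of \<open>H\<^sub>2\<close>, a coset from one side
  being joined to a coset from the other when they intersect. Being bipartite, it has no
  triangles; left translation acts on it by automorphisms; \<open>H\<^sub>1\<close> is adjacent to \<open>H\<^sub>2\<close>; and
  \<open>H\<^sub>1\<close> is adjacent to \<open>g H\<^sub>2\<close> iff \<open>g \<in> H\<^sub>1 H\<^sub>2\<close>.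

  Approximate this action on the two vertices \<open>H\<^sub>1\<close>, \<open>H\<^sub>2\<close> and on the group elements \<open>1\<close>, \<open>g\<close> and
  the generators of both subgroups. This gives an action on a finite graph with vertices \<open>y\<^sub>1\<close>,
  \<open>y\<^sub>2\<close>, where \<open>y\<^sub>i\<close> is fixed by the generators of \<open>H\<^sub>i\<close>, hence by all of \<open>H\<^sub>i\<close>, where \<open>y\<^sub>1\<close> is
  adjacent to \<open>y\<^sub>2\<close>, and where \<open>y\<^sub>1\<close> is not adjacent to \<open>g y\<^sub>2\<close>. An element \<open>h\<^sub>1 h\<^sub>2\<close> moves \<open>y\<^sub>2\<close> to
  \<open>h\<^sub>1 y\<^sub>2\<close>, which is adjacent to \<open>h\<^sub>1 y\<^sub>1 = y\<^sub>1\<close>. So no element of \<open>H\<^sub>1 H\<^sub>2\<close> acts on the finite graph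
  as \<open>g\<close> does; in other words, with \<open>K\<close> the kernel of the finite action, the open set \<open>g K\<close>
  misses \<open>H\<^sub>1 H\<^sub>2\<close>.

  The group is countable, so the coset graph is countable and has a copy in any infinite type.
\<close>

section \<open>Closed sets of the profinite topology\<close>

lemma (in group) closedin_profinite_topologyI:
  assumes "A \<subseteq> carrier G"
    and sep: "\<And>g. g \<in> carrier G \<Longrightarrow> g \<notin> A \<Longrightarrow> \<exists>K. finite_index_normal G K \<and> (g <# K) \<inter> A = {}"
  shows "closedin (profinite_topology G) A"
proof -
  let ?B = "{g <# K | g K. g \<in> carrier G \<and> finite_index_normal G K}"
  have sg: "subgroup K G" if "finite_index_normal G K" for K
    using that by (simp add: finite_index_normal_def normal_imp_subgroup)
  have sub: "U \<subseteq> carrier G" if "U \<in> ?B" for U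
    using that l_coset_subset_G[OF subgroup.subset[OF sg]] by force
  have mem: "g \<in> g <# K" if "g \<in> carrier G" "finite_index_normal G K" for g K
    using lcos_self[OF that(1) sg[OF that(2)]] .
  have "rcosets (carrier G) \<subseteq> {carrier G}"
    by (auto simp: RCOSETS_def coset_join2 subgroup_self)
  then have "finite_index_normal G (carrier G)"
    unfolding finite_index_normal_def by (simp add: normal_self finite_subset)
  then have "\<Union>?B = carrier G"
    using sub mem by blast
  then have top: "topspace (profinite_topology G) = carrier G"
    by (simp add: profinite_topology_def)
  have "\<exists>U. openin (profinite_topology G) U \<and> g \<in> U \<and> U \<subseteq> carrier G - A"
    if g: "g \<in> carrier G - A" for g
  proof -
    obtain K where K: "finite_index_normal G K" "(g <# K) \<inter> A = {}"
      using sep g by blast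
    then have B: "g <# K \<in> ?B"
      using g by blast
    show ?thesis
    proof (intro exI conjI)
      show "openin (profinite_topology G) (g <# K)"
        unfolding profinite_topology_def by (rule topology_generated_by_Basis[OF B])
      show "g \<in> g <# K"
        using g K(1) by (intro mem) simp_all
      show "g <# K \<subseteq> carrier G - A"
        using sub[OF B] K(2) by blast
    qed
  qed
  then have "openin (profinite_topology G) (carrier G - A)"
    by (subst openin_subopen) blast
  then show ?thesis
    using assms(1) top by (simp add: closedin_def)
qed

lemma (in group) subset_product_two:
  assumes "subgroup H\<^sub>1 G" "subgroup H\<^sub>2 G"
  shows "subset_product G [H\<^sub>1, H\<^sub>2] = H\<^sub>1 <#> H\<^sub>2"
proof -
  have "H\<^sub>2 <#> {\<one>} = H\<^sub>2"
    using subgroup.subset[OF assms(2)] by (force simp: set_mult_def)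
  then show ?thesis
    by (simp add: subset_product_def)
qed

section \<open>Group actions\<close>

text \<open>The restrictions make the maps elements of the symmetric group of \<open>V\<close>, whose
  elements are undefined outside \<open>V\<close>.\<close>

lemma (in group) group_actionI:
  assumes closed: "\<And>g v. g \<in> carrier G \<Longrightarrow> v \<in> V \<Longrightarrow> a g v \<in> V"
    and one: "\<And>v. v \<in> V \<Longrightarrow> a \<one> v = v"
    and mult: "\<And>g h v. g \<in> carrier G \<Longrightarrow> h \<in> carrier G \<Longrightarrow> v \<in> V \<Longrightarrow> a (g \<otimes> h) v = a g (a h v)"
  shows "group_action G V (\<lambda>g. restrict (a g) V)"
proof -
  have bij: "restrict (a g) V \<in> Bij V" if g: "g \<in> carrier G" for g
  proof -
    have "bij_betw (a g) V V"
    proof (rule bij_betw_byWitness[where f' = "a (inv g)"])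
      show "\<forall>v\<in>V. a (inv g) (a g v) = v"
        using g mult[of "inv g" g] one by simp
      show "\<forall>v\<in>V. a g (a (inv g) v) = v"
        using g mult[of g "inv g"] one by simp
    qed (use g closed in auto)
    then show ?thesis
      by (simp add: Bij_def)
  qed
  have "restrict (a (g \<otimes> h)) V = compose V (restrict (a g) V) (restrict (a h) V)"
    if "g \<in> carrier G" "h \<in> carrier G" for g h
    using that closed mult by (auto simp: compose_def restrict_def)
  then have "(\<lambda>g. restrict (a g) V) \<in> hom G (BijGroup V)"
    using bij by (auto simp: hom_def BijGroup_def)
  then show ?thesis
    by (intro group_action.intro group_hom.intro group_hom_axioms.intro group_BijGroup is_group)
qed

text \<open>The quotient by the kernel embeds into the symmetric group of \<open>E\<close>, which is finite.\<close>

lemma (in group_action) finite_index_normal_kernel: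
  assumes "finite E"
  shows "finite_index_normal G (kernel G (BijGroup E) \<phi>)"
proof -
  interpret h: group_hom G "BijGroup E" \<phi>
    by (rule group_hom)
  let ?K = "kernel G (BijGroup E) \<phi>"
  let ?q = "\<lambda>X. the_elem (\<phi> ` X)"
  have "Bij E \<subseteq> E \<rightarrow>\<^sub>E E"
    using Bij_imp_funcset Bij_imp_extensional by (auto simp: PiE_def)
  then have "finite (carrier (BijGroup E))"
    using assms finite_PiE[of E "\<lambda>_. E"] by (auto simp: BijGroup_def intro: finite_subset)
  moreover have "?q ` carrier (G Mod ?K) \<subseteq> carrier (BijGroup E)"
    using h.FactGroup_the_elem_mem by blast
  ultimately have "finite (carrier (G Mod ?K))"
    using h.FactGroup_inj_on finite_imageD finite_subset by blast
  then show ?thesis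
    using h.normal_kernel by (simp add: finite_index_normal_def FactGroup_def)
qed

lemma (in group_action) generate_fixes:
  assumes "y \<in> E" "S \<subseteq> carrier G" "\<And>s. s \<in> S \<Longrightarrow> \<phi> s y = y" "h \<in> generate G S"
  shows "\<phi> h y = y"
proof -
  interpret h: group_hom G "BijGroup E" \<phi>
    by (rule group_hom)
  have "generate G S \<subseteq> stabilizer G \<phi> y"
    using assms(2,3)
    by (intro group.generate_subgroup_incl[OF h.G.is_group] stabilizer_subgroup assms(1))
      (auto simp: stabilizer_def)
  then show ?thesis
    using assms(4) by (auto simp: stabilizer_def)
qed

text \<open>Adjacency to a vertex fixed by \<open>H\<^sub>1\<close> is invariant under \<open>H\<^sub>1\<close>, and the kernel does not
  change the image of \<open>y\<^sub>2\<close>; so a non-edge between \<open>y\<^sub>1\<close> and \<open>g y\<^sub>2\<close> excludes all of \<open>g K\<close> from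
  \<open>H\<^sub>1 H\<^sub>2\<close>.\<close>

lemma (in group) kernel_coset_disjoint:
  assumes act: "graph_action G Y D \<beta>"
    and y: "y\<^sub>1 \<in> Y" "y\<^sub>2 \<in> Y"
    and sub: "H\<^sub>1 \<subseteq> carrier G" "H\<^sub>2 \<subseteq> carrier G"
    and fix1: "\<And>h. h \<in> H\<^sub>1 \<Longrightarrow> \<beta> h y\<^sub>1 = y\<^sub>1"
    and fix2: "\<And>h. h \<in> H\<^sub>2 \<Longrightarrow> \<beta> h y\<^sub>2 = y\<^sub>2"
    and edge: "(y\<^sub>1, y\<^sub>2) \<in> D"
    and g: "g \<in> carrier G" and nonedge: "(y\<^sub>1, \<beta> g y\<^sub>2) \<notin> D"
  shows "(g <# kernel G (BijGroup Y) \<beta>) \<inter> (H\<^sub>1 <#> H\<^sub>2) = {}"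
proof (rule ccontr)
  interpret group_action G Y \<beta>
    using act by (simp add: graph_action_def)
  assume "(g <# kernel G (BijGroup Y) \<beta>) \<inter> (H\<^sub>1 <#> H\<^sub>2) \<noteq> {}"
  then obtain k h\<^sub>1 h\<^sub>2 where k: "k \<in> kernel G (BijGroup Y) \<beta>"
    and h: "h\<^sub>1 \<in> H\<^sub>1" "h\<^sub>2 \<in> H\<^sub>2" and eq: "g \<otimes> k = h\<^sub>1 \<otimes> h\<^sub>2"
    unfolding l_coset_def set_mult_def by blast
  have kG: "k \<in> carrier G" and "\<beta> k y\<^sub>2 = y\<^sub>2"
    using k y(2) by (auto simp: kernel_def BijGroup_def)
  have hG: "h\<^sub>1 \<in> carrier G" "h\<^sub>2 \<in> carrier G"
    using h sub by auto
  have "\<beta> g y\<^sub>2 = \<beta> (g \<otimes> k) y\<^sub>2"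
    using composition_rule[OF y(2) g kG] \<open>\<beta> k y\<^sub>2 = y\<^sub>2\<close> by simp
  also have "\<dots> = \<beta> h\<^sub>1 y\<^sub>2"
    using composition_rule[OF y(2) hG] fix2[OF h(2)] eq by simp
  finally have "(\<beta> h\<^sub>1 y\<^sub>1, \<beta> h\<^sub>1 y\<^sub>2) \<notin> D"
    using nonedge fix1[OF h(1)] by simp
  then show False
    using act hG(1) y edge by (simp add: graph_action_def)
qed

section \<open>Copies of an action on a graph\<close>

lemma triangle_free_graph_iff:
  "triangle_free_graph V E \<longleftrightarrow>
     simple_graph V E \<and> (\<forall>u v w. (u, v) \<in> E \<longrightarrow> (v, w) \<in> E \<longrightarrow> (u, w) \<notin> E)"
proof -
  have "(\<exists>C. clique V E C \<and> card C = 3) \<longleftrightarrow> (\<exists>u v w. (u, v) \<in> E \<and> (v, w) \<in> E \<and> (u, w) \<in> E)"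
    if s: "simple_graph V E"
  proof
    assume "\<exists>C. clique V E C \<and> card C = 3"
    then obtain u v w where "clique V E {u, v, w}" "u \<noteq> v" "v \<noteq> w" "u \<noteq> w"
      by (auto simp: card_3_iff)
    then have "(u, v) \<in> E" "(v, w) \<in> E" "(u, w) \<in> E"
      by (simp_all add: clique_def)
    then show "\<exists>u v w. (u, v) \<in> E \<and> (v, w) \<in> E \<and> (u, w) \<in> E"
      by blast
  next
    assume "\<exists>u v w. (u, v) \<in> E \<and> (v, w) \<in> E \<and> (u, w) \<in> E"
    then obtain u v w where e: "(u, v) \<in> E" "(v, w) \<in> E" "(u, w) \<in> E"
      by blast
    then have "(v, u) \<in> E" "(w, v) \<in> E" "(w, u) \<in> E" "{u, v, w} \<subseteq> V"
      using s by (auto simp: simple_graph_def sym_def)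
    moreover have "u \<noteq> v" "v \<noteq> w" "u \<noteq> w"
      using s e by (auto simp: simple_graph_def irrefl_def)
    ultimately have "clique V E {u, v, w}" "card {u, v, w} = 3"
      using e by (auto simp: clique_def)
    then show "\<exists>C. clique V E C \<and> card C = 3"
      by blast
  qed
  then show ?thesis
    unfolding triangle_free_graph_def by blast
qed

lemma induced_embedding_edge_iff:
  "induced_embedding A E W D e \<Longrightarrow> u \<in> A \<Longrightarrow> v \<in> A \<Longrightarrow> (e u, e v) \<in> D \<longleftrightarrow> (u, v) \<in> E"
  by (simp add: induced_embedding_def)

lemma induced_embedding_vertex: "induced_embedding A E W D e \<Longrightarrow> u \<in> A \<Longrightarrow> e u \<in> W"
  by (auto simp: induced_embedding_def)

lemma induced_embedding_comp:
  assumes e: "induced_embedding (j ` A) E' W D e" and inj: "inj_on j A"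
    and edge: "\<And>u v. u \<in> A \<Longrightarrow> v \<in> A \<Longrightarrow> (j u, j v) \<in> E' \<longleftrightarrow> (u, v) \<in> E"
  shows "induced_embedding A E W D (e \<circ> j)"
  using comp_inj_on[OF inj, of e] e edge by (auto simp: induced_embedding_def)

text \<open>This lets a hypothesis about graphs with vertices in one fixed type be applied to a graph
  whose vertices are cosets.\<close>

lemma (in group) finitely_approximable_via_copy:
  fixes V :: "'v set" and j :: "'v \<Rightarrow> 'w"
  assumes inj: "inj_on j V"
    and tf: "triangle_free_graph V E"
    and act: "graph_action G V E \<alpha>"
    and approx: "\<And>(V' :: 'w set) E' \<alpha>'. triangle_free_graph V' E' \<Longrightarrow> graph_action G V' E' \<alpha>' \<Longrightarrow>
                   finitely_approximable G V' E' \<alpha>'"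
  shows "finitely_approximable G V E \<alpha>"
proof -
  interpret group_action G V \<alpha>
    using act by (simp add: graph_action_def)
  define E' where "E' = map_prod j j ` E"
  define \<alpha>' where "\<alpha>' = (\<lambda>g. restrict (\<lambda>v. j (\<alpha> g (inv_into V j v))) (j ` V))"
  have EV: "E \<subseteq> V \<times> V"
    using tf by (simp add: triangle_free_graph_def simple_graph_def)
  have edge: "(j u, j v) \<in> E' \<longleftrightarrow> (u, v) \<in> E" if "u \<in> V" "v \<in> V" for u v
    using that EV inj unfolding E'_def by (auto dest: inj_onD)
  have E'V: "E' \<subseteq> j ` V \<times> j ` V"
    using EV by (auto simp: E'_def)
  have closed: "\<alpha> g v \<in> V" if "g \<in> carrier G" "v \<in> V" for g v
    using element_image that by blast
  have \<alpha>': "\<alpha>' g (j v) = j (\<alpha> g v)" if "v \<in> V" for g v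
    using that inj by (simp add: \<alpha>'_def)
  have "triangle_free_graph (j ` V) E'"
  proof -
    have "sym E'" "irrefl E'"
      using tf EV inj unfolding triangle_free_graph_def simple_graph_def E'_def sym_def irrefl_def
      by (auto dest: inj_onD)
    moreover have "(x, z) \<notin> E'" if xyz: "(x, y) \<in> E'" "(y, z) \<in> E'" for x y z
    proof -
      obtain u v w where "u \<in> V" "v \<in> V" "w \<in> V" "x = j u" "y = j v" "z = j w"
        using xyz E'V by blast
      then show ?thesis
        using xyz edge tf unfolding triangle_free_graph_iff by blast
    qed
    ultimately show ?thesis
      using E'V unfolding triangle_free_graph_iff simple_graph_def by blast
  qed
  moreover have "graph_action G (j ` V) E' \<alpha>'"
  proof -
    have "\<alpha> \<one> v = v" if "v \<in> V" for v
      using that id_eq_one by (metis restrict_apply')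
    then have "group_action G (j ` V) \<alpha>'"
      unfolding \<alpha>'_def using inj closed composition_rule by (intro group_actionI) auto
    then show ?thesis
      using \<alpha>' edge closed act by (auto simp: graph_action_def)
  qed
  ultimately have ap: "finitely_approximable G (j ` V) E' \<alpha>'"
    by (rule approx)
  show ?thesis
    unfolding finitely_approximable_def
  proof (intro allI impI)
    fix F X0
    assume *: "finite F \<and> F \<subseteq> carrier G \<and> \<one> \<in> F \<and> finite X0 \<and> X0 \<subseteq> V"
    let ?A = "{\<alpha> f x | f x. f \<in> F \<and> x \<in> X0}"
    have AV: "?A \<subseteq> V"
      using * closed by blast
    have A': "{\<alpha>' f x | f x. f \<in> F \<and> x \<in> j ` X0} = j ` ?A"
    proof -
      have "\<alpha>' f (j x) = j (\<alpha> f x)" if "x \<in> X0" for f x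
        using * that by (intro \<alpha>') blast
      then have "{\<alpha>' f x | f x. f \<in> F \<and> x \<in> j ` X0} = {j (\<alpha> f x) | f x. f \<in> F \<and> x \<in> X0}"
        by (simp add: Bex_def image_def) metis
      then show ?thesis
        by blast
    qed
    have "finite F \<and> F \<subseteq> carrier G \<and> \<one> \<in> F \<and> finite (j ` X0) \<and> j ` X0 \<subseteq> j ` V"
      using * by blast
    from ap[unfolded finitely_approximable_def, rule_format, OF this]
    obtain Y :: "nat set" and D \<beta> e where Y: "finite Y" "triangle_free_graph Y D"
      "graph_action G Y D \<beta>" and e: "induced_embedding (j ` ?A) E' Y D e"
      and eq: "\<forall>f\<in>F. \<forall>x\<in>j ` X0. \<beta> f (e x) = e (\<alpha>' f x)"
      unfolding A' by blast
    have "induced_embedding ?A E Y D (e \<circ> j)"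
      by (rule induced_embedding_comp[OF e inj_on_subset[OF inj AV]
            edge[OF subsetD[OF AV] subsetD[OF AV]]])
    moreover have "\<forall>f\<in>F. \<forall>x\<in>X0. \<beta> f ((e \<circ> j) x) = (e \<circ> j) (\<alpha> f x)"
    proof (intro ballI)
      fix f x assume "f \<in> F" "x \<in> X0"
      then have "x \<in> V"
        using * by blast
      then show "\<beta> f ((e \<circ> j) x) = (e \<circ> j) (\<alpha> f x)"
        using eq \<open>f \<in> F\<close> \<open>x \<in> X0\<close> \<alpha>' by simp
    qed
    ultimately show "\<exists>(Y :: nat set) D \<beta> e. finite Y \<and> triangle_free_graph Y D \<and>
        graph_action G Y D \<beta> \<and> induced_embedding ?A E Y D e \<and>
        (\<forall>f\<in>F. \<forall>x\<in>X0. \<beta> f (e x) = e (\<alpha> f x))"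
      using Y by blast
  qed
qed

section \<open>The coset graph of two subgroups\<close>

text \<open>The Boolean tag keeps the two sides apart even when the subgroups coincide.\<close>

definition coset_vertices :: "('g, 'm) monoid_scheme \<Rightarrow> (bool \<Rightarrow> 'g set) \<Rightarrow> (bool \<times> 'g set) set" where
  "coset_vertices G H = (SIGMA b:UNIV. lcosets\<^bsub>G\<^esub> (H b))"

definition coset_edges ::
  "('g, 'm) monoid_scheme \<Rightarrow> (bool \<Rightarrow> 'g set) \<Rightarrow> ((bool \<times> 'g set) \<times> (bool \<times> 'g set)) set" where
  "coset_edges G H = {(u, v). u \<in> coset_vertices G H \<and> v \<in> coset_vertices G H \<and>
     fst u \<noteq> fst v \<and> snd u \<inter> snd v \<noteq> {}}"

definition coset_action ::
  "('g, 'm) monoid_scheme \<Rightarrow> (bool \<Rightarrow> 'g set) \<Rightarrow> 'g \<Rightarrow> bool \<times> 'g set \<Rightarrow> bool \<times> 'g set" where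
  "coset_action G H g = restrict (map_prod id (l_coset G g)) (coset_vertices G H)"

lemma triangle_free_coset_graph: "triangle_free_graph (coset_vertices G H) (coset_edges G H)"
  unfolding triangle_free_graph_iff simple_graph_def
  by (auto simp: coset_edges_def sym_def irrefl_def)

lemma countable_coset_vertices:
  assumes "countable (carrier G)"
  shows "countable (coset_vertices G H)"
  using assms by (simp add: coset_vertices_def LCOSETS_def)

lemma (in group) l_coset_Int_empty_iff:
  assumes "g \<in> carrier G" "A \<subseteq> carrier G" "B \<subseteq> carrier G"
  shows "(g <# A) \<inter> (g <# B) = {} \<longleftrightarrow> A \<inter> B = {}"
proof -
  have "g <# C = (\<otimes>) g ` C" for C
    by (auto simp: l_coset_def)
  then show ?thesis
    using inj_on_image_Int[OF inj_on_cmult[OF assms(1)] assms(2,3)] by (metis image_is_empty)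
qed

lemma (in group) graph_action_coset_graph:
  assumes H: "\<And>b. subgroup (H b) G"
  shows "graph_action G (coset_vertices G H) (coset_edges G H) (coset_action G H)"
proof -
  have sub: "C \<subseteq> carrier G" if "(b, C) \<in> coset_vertices G H" for b C
    using that lcosets_subset_PowG[OF H] by (auto simp: coset_vertices_def)
  have closed: "(b, g <# C) \<in> coset_vertices G H"
    if g: "g \<in> carrier G" and C: "(b, C) \<in> coset_vertices G H" for g b C
  proof -
    obtain a where a: "a \<in> carrier G" "C = a <# H b"
      using C by (auto simp: coset_vertices_def LCOSETS_def)
    then have "g <# C = (g \<otimes> a) <# H b"
      using g lcos_m_assoc subgroup.subset[OF H] by simp
    then show ?thesis
      using a g by (auto simp: coset_vertices_def LCOSETS_def)
  qed
  have "group_action G (coset_vertices G H) (coset_action G H)"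
    unfolding coset_action_def
    by (intro group_actionI) (auto simp: closed lcos_mult_one lcos_m_assoc dest: sub)
  then show ?thesis
    using closed sub unfolding graph_action_def
    by (simp add: coset_edges_def coset_action_def l_coset_Int_empty_iff split_paired_all)
qed

lemma (in group) subgroup_meets_l_coset_iff:
  assumes "subgroup H\<^sub>1 G" "subgroup H\<^sub>2 G" "g \<in> carrier G"
  shows "H\<^sub>1 \<inter> (g <# H\<^sub>2) \<noteq> {} \<longleftrightarrow> g \<in> H\<^sub>1 <#> H\<^sub>2"
proof
  assume "H\<^sub>1 \<inter> (g <# H\<^sub>2) \<noteq> {}"
  then obtain h where h: "g \<otimes> h \<in> H\<^sub>1" "h \<in> H\<^sub>2"
    by (auto simp: l_coset_def)
  then have "g = (g \<otimes> h) \<otimes> inv h"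
    using assms(3) subgroup.mem_carrier[OF assms(2)] by (simp add: m_assoc)
  then show "g \<in> H\<^sub>1 <#> H\<^sub>2"
    using h subgroup.m_inv_closed[OF assms(2)] unfolding set_mult_def by blast
next
  assume "g \<in> H\<^sub>1 <#> H\<^sub>2"
  then obtain h\<^sub>1 h\<^sub>2 where h: "h\<^sub>1 \<in> H\<^sub>1" "h\<^sub>2 \<in> H\<^sub>2" "g = h\<^sub>1 \<otimes> h\<^sub>2"
    by (auto simp: set_mult_def)
  then have "h\<^sub>1 = g \<otimes> inv h\<^sub>2"
    using subgroup.mem_carrier[OF assms(1)] subgroup.mem_carrier[OF assms(2)]
    by (simp add: m_assoc)
  then show "H\<^sub>1 \<inter> (g <# H\<^sub>2) \<noteq> {}"
    using h subgroup.m_inv_closed[OF assms(2)] unfolding l_coset_def by blast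
qed

section \<open>Separating an element from a product of two subgroups\<close>

text \<open>Only the adjacencies of \<open>H\<^sub>1\<close> with \<open>H\<^sub>2\<close> and with \<open>g H\<^sub>2\<close> and the invariance of \<open>H\<^sub>i\<close> under
  its generators have to survive in the finite graph. Finite generation makes this a finite
  amount of data.\<close>

lemma (in group) separate_from_product:
  assumes S: "finite S\<^sub>1" "S\<^sub>1 \<subseteq> carrier G" "finite S\<^sub>2" "S\<^sub>2 \<subseteq> carrier G"
    and H: "H = (\<lambda>b. generate G (if b then S\<^sub>2 else S\<^sub>1))"
    and approx: "finitely_approximable G (coset_vertices G H) (coset_edges G H) (coset_action G H)"
    and g: "g \<in> carrier G" "g \<notin> H False <#> H True"
  shows "\<exists>K. finite_index_normal G K \<and> (g <# K) \<inter> (H False <#> H True) = {}"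
proof -
  let ?V = "coset_vertices G H" and ?a = "coset_action G H"
  let ?v = "\<lambda>b. (b, H b)"
  define F where "F = insert \<one> (insert g (S\<^sub>1 \<union> S\<^sub>2))"
  have sg: "subgroup (H b) G" for b
    using S by (auto simp: H intro: generate_is_subgroup)
  have HG: "H b \<subseteq> carrier G" for b
    using sg subgroup.subset by blast
  have vV: "(b, c <# H b) \<in> ?V" if "c \<in> carrier G" for b c
    using that by (auto simp: coset_vertices_def LCOSETS_def)
  have v: "?v b \<in> ?V" for b
    using vV[of \<one> b] by (simp add: lcos_mult_one HG)
  have av: "?a c (?v b) = (b, c <# H b)" for b c
    using v by (simp add: coset_action_def)
  have fixed: "?a s (?v b) = ?v b" if "s \<in> H b" for s b
    unfolding av using coset_join3[OF _ sg that] that HG by blast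
  have "finite F \<and> F \<subseteq> carrier G \<and> \<one> \<in> F \<and> finite (range ?v) \<and> range ?v \<subseteq> ?V"
    using S g v by (auto simp: F_def)
  from approx[unfolded finitely_approximable_def, rule_format, OF this]
  obtain Y :: "nat set" and D \<beta> e where Y: "finite Y" and act: "graph_action G Y D \<beta>"
    and emb: "induced_embedding {?a f x | f x. f \<in> F \<and> x \<in> range ?v} (coset_edges G H) Y D e"
    and "\<forall>f\<in>F. \<forall>x\<in>range ?v. \<beta> f (e x) = e (?a f x)"
    by blast
  then have eq: "\<beta> f (e (?v b)) = e (?a f (?v b))" if "f \<in> F" for f b
    using that by blast
  let ?A = "{?a f x | f x. f \<in> F \<and> x \<in> range ?v}"
  interpret group_action G Y \<beta>
    using act by (simp add: graph_action_def)
  have vA: "?v b \<in> ?A" for b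
  proof -
    have "?v b = ?a \<one> (?v b)"
      by (simp add: av lcos_mult_one HG)
    moreover have "\<one> \<in> F"
      by (simp add: F_def)
    ultimately show ?thesis
      by blast
  qed
  have gA: "?a g (?v True) \<in> ?A"
    unfolding F_def by blast
  have y: "e (?v b) \<in> Y" for b
    by (rule induced_embedding_vertex[OF emb vA])
  note D = induced_embedding_edge_iff[OF emb]
  have fixes_all: "\<beta> h (e (?v b)) = e (?v b)" if "h \<in> H b" for h b
  proof (rule generate_fixes[OF y])
    let ?S = "if b then S\<^sub>2 else S\<^sub>1"
    show "?S \<subseteq> carrier G"
      using S by simp
    show "h \<in> generate G ?S"
      using that by (simp add: H)
    show "\<beta> s (e (?v b)) = e (?v b)" if "s \<in> ?S" for s
    proof -
      have "s \<in> F"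
        using that by (auto simp: F_def split: if_splits)
      moreover have "s \<in> H b"
        using that by (simp add: H generate.incl)
      ultimately show ?thesis
        using eq fixed by simp
    qed
  qed
  have "\<one> \<in> H False \<inter> H True"
    using sg subgroup.one_closed by blast
  \<comment> \<open>The vertices \<open>H\<^sub>1\<close> and \<open>H\<^sub>2\<close> share the identity, so they are joined.\<close>
  then have edge: "(e (?v False), e (?v True)) \<in> D"
    unfolding D[OF vA vA] using v by (auto simp: coset_edges_def)
  have "(?v False, ?a g (?v True)) \<notin> coset_edges G H"
    using subgroup_meets_l_coset_iff[OF sg sg g(1)] g(2) unfolding av by (auto simp: coset_edges_def)
  then have "(e (?v False), \<beta> g (e (?v True))) \<notin> D"
    using D[OF vA gA] eq[of g True] by (simp add: F_def)
  with edge have "(g <# kernel G (BijGroup Y) \<beta>) \<inter> (H False <#> H True) = {}"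
    by (intro kernel_coset_disjoint[OF act y y HG HG fixes_all fixes_all _ g(1)])
  then show ?thesis
    using finite_index_normal_kernel[OF Y] by blast
qed

theorem theorem1p12:
  fixes G :: "('g, 'm) monoid_scheme"
  assumes "group G"
    and "countable (carrier G)"
    and "\<And>(V :: 'v::infinite set) E \<alpha>.
           triangle_free_graph V E \<Longrightarrow> graph_action G V E \<alpha> \<Longrightarrow> finitely_approximable G V E \<alpha>"
  shows "RZ_property 2 G"
  unfolding RZ_property_def
proof (intro allI impI)
  interpret group G
    by (rule assms(1))
  fix Hs :: "'g set list"
  assume Hs: "length Hs = 2 \<and> (\<forall>H\<in>set Hs. fg_subgroup G H)"
  then obtain H\<^sub>1 H\<^sub>2 where Hs_eq: "Hs = [H\<^sub>1, H\<^sub>2]"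
    by (auto simp: length_Suc_conv numeral_2_eq_2)
  with Hs obtain S\<^sub>1 S\<^sub>2 where S: "finite S\<^sub>1" "S\<^sub>1 \<subseteq> carrier G" "finite S\<^sub>2" "S\<^sub>2 \<subseteq> carrier G"
    and gen: "H\<^sub>1 = generate G S\<^sub>1" "H\<^sub>2 = generate G S\<^sub>2"
    by (auto simp: fg_subgroup_def)
  define H where "H = (\<lambda>b. generate G (if b then S\<^sub>2 else S\<^sub>1))"
  have H12: "H False = H\<^sub>1" "H True = H\<^sub>2"
    by (simp_all add: H_def gen)
  have sg: "subgroup (H b) G" for b
    using S by (auto simp: H_def intro: generate_is_subgroup)
  obtain i :: "nat \<Rightarrow> 'v" where i: "inj i"
    using infinite_countable_subset[OF infinite_UNIV] by blast
  let ?j = "i \<circ> to_nat_on (coset_vertices G H)"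
  have "inj_on ?j (coset_vertices G H)"
    using inj_on_to_nat_on[OF countable_coset_vertices[OF assms(2)]] i
    by (blast intro: comp_inj_on inj_on_subset)
  then have "finitely_approximable G (coset_vertices G H) (coset_edges G H) (coset_action G H)"
    by (rule finitely_approximable_via_copy[OF _ triangle_free_coset_graph
          graph_action_coset_graph[OF sg] assms(3)])
  then have "\<exists>K. finite_index_normal G K \<and> (g <#\<^bsub>G\<^esub> K) \<inter> (H\<^sub>1 <#>\<^bsub>G\<^esub> H\<^sub>2) = {}"
    if "g \<in> carrier G" "g \<notin> H\<^sub>1 <#>\<^bsub>G\<^esub> H\<^sub>2" for g
    using separate_from_product[OF S H_def] that by (simp add: H12)
  moreover have "H\<^sub>1 <#>\<^bsub>G\<^esub> H\<^sub>2 \<subseteq> carrier G"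
    using set_mult_closed[OF subgroup.subset[OF sg] subgroup.subset[OF sg]] H12 by metis
  ultimately have "closedin (profinite_topology G) (H\<^sub>1 <#>\<^bsub>G\<^esub> H\<^sub>2)"
    by (intro closedin_profinite_topologyI)
  then show "closedin (profinite_topology G) (subset_product G Hs)"
    using subset_product_two[OF sg sg, of False True] by (simp add: Hs_eq H12)
qed

end
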